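(* Let $G=(V,E)$ be a finite simple graph. The following are equivalent: (1) There exists a graph $G'$ on the vertex set $V$ such that $\operatorname{M}(G')=G$. (2) $\overline{G}$ is metamour-complementary, i.e., $\operatorname{M}(\overline{G})=G$. (3) For every $xy\in E$, there exists $z\in V\setminus\{x,y\}$ with $xz\notin E$ and $yz\notin E$. (4) $\operatorname{diam}(\overline{G})\le 2$.
   Context: All graphs are finite and simple with nonempty vertex set. The metamour graph $\operatorname{M}(G)$ of a graph $G$ is the graph with vertex set $V(G)$ in which $x,y$ are adjacent if and only if $d_G(x,y)=2$, where $d_G$ is the distance function ($d_G(x,y)=\infty$ if $x,y$ lie in different components). $\overline{G}$ is the complement of $G$. The diameter $\operatorname{diam}(G)$ is the maximum value of $d_G$; a disconnected graph has infinite diameter. A graph $H$ is metamour-complementary if $\operatorname{M}(H)=\overline{H}$. Equality of graphs means equality as labeled graphs (same vertices and same edges). *)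

theory Defs
  imports "Graph_Theory.Graph_Theory"
begin

text \<open>
  Finite simple graphs are the instances of the locale \<open>pair_graph\<close>: a finite vertex set together
  with a symmetric irreflexive set of arcs, an edge \<open>xy\<close> being represented by both \<open>(x, y)\<close> and
  \<open>(y, x)\<close>. Equality of the records is equality of labeled graphs. The locale does not require the
  vertex set to be nonempty.
\<close>

text \<open>Every arc has weight 1; the value is \<open>\<infinity>\<close> when \<open>y\<close> is not reachable from \<open>x\<close>.\<close>

definition gdist :: "'a pair_pre_digraph \<Rightarrow> 'a \<Rightarrow> 'a \<Rightarrow> ereal" where
  "gdist G x y = wf_digraph.\<mu> (with_proj G) (\<lambda>_. 1) x y"

definition diam :: "'a pair_pre_digraph \<Rightarrow> ereal" where
  "diam G = Max {gdist G x y | x y. x \<in> pverts G \<and> y \<in> pverts G}"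

definition complement :: "'a pair_pre_digraph \<Rightarrow> 'a pair_pre_digraph" where
  "complement G = \<lparr> pverts = pverts G,
     parcs = {(x, y). x \<in> pverts G \<and> y \<in> pverts G \<and> x \<noteq> y \<and> (x, y) \<notin> parcs G} \<rparr>"

definition metamour_graph :: "'a pair_pre_digraph \<Rightarrow> 'a pair_pre_digraph" where
  "metamour_graph G = \<lparr> pverts = pverts G,
     parcs = {(x, y). x \<in> pverts G \<and> y \<in> pverts G \<and> gdist G x y = 2} \<rparr>"

definition metamour_complementary :: "'a pair_pre_digraph \<Rightarrow> bool" where
  "metamour_complementary H \<longleftrightarrow> metamour_graph H = complement H"

lemma (in pair_wf_digraph) gdist_eq_INF_length:
  "gdist G x y = (INF p\<in>{p. awalk x p y}. ereal (real (length p)))"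
proof -
  have "awalk_cost (\<lambda>_. 1) p = real (length p)" for p :: "('a \<times> 'a) list"
    by (induction p) auto
  then show ?thesis
    by (simp add: gdist_def \<mu>_def)
qed

lemma (in pair_graph) pair_graph_complement: "pair_graph (complement G)"
proof -
  have sub: "parcs (complement G) \<subseteq> pverts G \<times> pverts G"
    by (auto simp: complement_def)
  have "finite (parcs (complement G))"
    using finite_subset[OF sub] pair_finite_verts by blast
  moreover have "symmetric (with_proj (complement G))"
    unfolding symmetric_def with_proj_simps
    using arcs_symmetric by (auto simp: complement_def intro!: symI)
  ultimately show ?thesis
    using pair_finite_verts
    by unfold_locales (auto simp: complement_def)
qed

lemma (in pair_graph) gdist_commute: "gdist G x y = gdist G y x"
proof -
  have snoc: "pcas u (p @ [(v, w)]) w" if "pcas u p v" for u v w :: 'a and p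
    using that by (induction p arbitrary: u) auto
  have rev_cas: "pcas v (rev (map prod.swap p)) u" if "pcas u p v" for u v :: 'a and p
    using that
  proof (induction p arbitrary: u)
    case (Cons e p)
    then have "pcas v (rev (map prod.swap p)) (snd e)" by simp
    from snoc[OF this, of u] Cons.prems show ?case by (cases e) simp
  qed simp
  have last: "v \<in> pverts G" if "awalk u p v" for u v p
    using that by (rule awalk_last_in_verts)
  have rev: "awalk v (rev (map prod.swap p)) u" if "awalk u p v" for u v p
    using that last[OF that] rev_cas arcs_symmetric
    by (auto simp: awalk_def)
  have le: "gdist G u v \<le> gdist G v u" for u v
    unfolding gdist_eq_INF_length
    by (rule INF_mono) (auto intro!: exI[of _ "rev (map prod.swap _)"] dest: rev)
  show ?thesis
    using le by (rule antisym) (rule le)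
qed

lemma (in pair_graph) pair_graph_metamour_graph: "pair_graph (metamour_graph G)"
proof -
  have sub: "parcs (metamour_graph G) \<subseteq> pverts G \<times> pverts G"
    by (auto simp: metamour_graph_def)
  have fin: "finite (parcs (metamour_graph G))"
    using finite_subset[OF sub] pair_finite_verts by blast
  have sym: "symmetric (with_proj (metamour_graph G))"
    unfolding symmetric_def with_proj_simps
    by (auto simp: metamour_graph_def gdist_commute intro!: symI)
  have "gdist G x x \<noteq> 2" if "x \<in> pverts G" for x
  proof -
    have "gdist G x x \<le> ereal (real (length []))"
      unfolding gdist_eq_INF_length using that
      by (intro INF_lower2[where i = "[]"]) (simp_all add: awalk_Nil_iff)
    then show ?thesis by auto
  qed
  with fin sym show ?thesis
    using pair_finite_verts
    by unfold_locales (auto simp: metamour_graph_def)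
qed

end

theory Submission
  imports Defs
begin

text \<open>
  All conditions speak about pairs at distance at most 2, which can be recognised locally:
  distinct vertices are at distance 2 exactly if they are non-adjacent and have a common neighbour
  (\<open>gdist_eq_two_iff\<close>).
  In the complement of a graph, the non-adjacent pairs are the edges of the graph. The metamour graph
  of the complement is therefore always a subgraph of the graph itself, consisting of the edges whose
  end vertices have a common non-neighbour. It is the whole graph exactly if every edge has this
  property. Since all other pairs are at distance at most 1 in the complement, this also says
  exactly that the diameter of the complement is at most 2.

  If the graph is the metamour graph of some other graph, then the end vertices of an edge have a
  common neighbour there. This vertex is at distance 1 from both ends, hence adjacent to neither of
  them in the metamour graph, so it is the common non-neighbour that is required
  (\<open>metamours_common_non_metamour\<close>).
\<close>

text \<open>
  The infimum that defines the distance ranges over natural numbers, so whenever it is finite it is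
  the length of some walk. As a bound, this also covers pairs without any walk between them.
\<close>

lemma (in pair_wf_digraph) gdist_le_iff_awalk:
  "gdist G x y \<le> ereal (real n) \<longleftrightarrow> (\<exists>p. awalk x p y \<and> length p \<le> n)"
proof
  assume le: "gdist G x y \<le> ereal (real n)"
  show "\<exists>p. awalk x p y \<and> length p \<le> n"
  proof (rule ccontr)
    assume "\<not> ?thesis"
    then have "Suc n \<le> length p" if "awalk x p y" for p
      using that not_less_eq_eq by blast
    then have "ereal (real (Suc n)) \<le> gdist G x y"
      unfolding gdist_eq_INF_length by (intro INF_greatest) (simp del: of_nat_Suc)
    with le have "ereal (real (Suc n)) \<le> ereal (real n)"
      by (rule order_trans[rotated])
    then show False by simp
  qed
next
  assume "\<exists>p. awalk x p y \<and> length p \<le> n"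
  then show "gdist G x y \<le> ereal (real n)"
    unfolding gdist_eq_INF_length by (auto intro: INF_lower2)
qed

lemma (in pair_wf_digraph) gdist_le_one_iff:
  assumes "x \<in> pverts G"
  shows "gdist G x y \<le> 1 \<longleftrightarrow> x = y \<or> (x, y) \<in> parcs G"
proof -
  have "(\<exists>p. awalk x p y \<and> length p \<le> 1) \<longleftrightarrow> x = y \<or> (x, y) \<in> parcs G"
  proof
    assume "\<exists>p. awalk x p y \<and> length p \<le> 1"
    then obtain p where "awalk x p y" "length p \<le> 1" by blast
    then show "x = y \<or> (x, y) \<in> parcs G"
      by (cases p) (auto simp: awalk_def)
  next
    assume "x = y \<or> (x, y) \<in> parcs G"
    then consider "awalk x [] y" | "awalk x [(x, y)] y"
      using assms by (auto simp: awalk_def)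
    then show "\<exists>p. awalk x p y \<and> length p \<le> 1"
    proof cases
      case 1
      then show ?thesis by (intro exI[of _ "[]"]) simp
    next
      case 2
      then show ?thesis by (intro exI[of _ "[(x, y)]"]) simp
    qed
  qed
  then show ?thesis
    using gdist_le_iff_awalk[of x y 1] by (simp add: one_ereal_def)
qed

lemma (in pair_wf_digraph) gdist_le_two_iff:
  assumes "x \<in> pverts G"
  shows "gdist G x y \<le> 2 \<longleftrightarrow>
    x = y \<or> (x, y) \<in> parcs G \<or> (\<exists>z. (x, z) \<in> parcs G \<and> (z, y) \<in> parcs G)"
    (is "_ \<longleftrightarrow> ?near")
proof -
  have "(\<exists>p. awalk x p y \<and> length p \<le> 2) \<longleftrightarrow> ?near"
  proof
    assume "\<exists>p. awalk x p y \<and> length p \<le> 2"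
    then obtain p where p: "awalk x p y" "length p \<le> 2" by blast
    then consider "p = []" | e where "p = [e]" | e f where "p = [e, f]"
      by (cases p; cases "tl p") auto
    then show ?near
      using p(1) by cases (auto simp: awalk_def)
  next
    assume ?near
    then consider "awalk x [] y" | "awalk x [(x, y)] y" | z where "awalk x [(x, z), (z, y)] y"
      using assms by (auto simp: awalk_def)
    then show "\<exists>p. awalk x p y \<and> length p \<le> 2"
    proof cases
      case 1
      then show ?thesis by (intro exI[of _ "[]"]) simp
    next
      case 2
      then show ?thesis by (intro exI[of _ "[(x, y)]"]) simp
    next
      case 3
      then show ?thesis by (intro exI[of _ "[(x, z), (z, y)]"]) simp
    qed
  qed
  then show ?thesis
    using gdist_le_iff_awalk[of x y 2] by simp
qed

lemma (in pair_wf_digraph) gdist_eq_two_iff: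
  assumes "x \<in> pverts G"
  shows "gdist G x y = 2 \<longleftrightarrow>
    x \<noteq> y \<and> (x, y) \<notin> parcs G \<and> (\<exists>z. (x, z) \<in> parcs G \<and> (z, y) \<in> parcs G)"
proof -
  \<comment> \<open>Distances are integral or infinite, so a distance exceeding 1 is at least 2.\<close>
  have "2 \<le> gdist G x y" if "\<not> gdist G x y \<le> 1"
  proof -
    have "\<not> length p \<le> 1" if "awalk x p y" for p
      using \<open>\<not> gdist G x y \<le> 1\<close> gdist_le_iff_awalk[of x y 1] that
      by (auto simp: one_ereal_def)
    then show ?thesis
      unfolding gdist_eq_INF_length by (intro INF_greatest) (force simp: not_le)
  qed
  moreover have "\<not> (2::ereal) \<le> 1" by simp
  ultimately have "gdist G x y = 2 \<longleftrightarrow> gdist G x y \<le> 2 \<and> \<not> gdist G x y \<le> 1"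
    by (metis order_antisym order_refl)
  then show ?thesis
    using gdist_le_one_iff[OF assms] gdist_le_two_iff[OF assms] by auto
qed

lemma (in pair_graph) diam_le_iff:
  assumes "pverts G \<noteq> {}"
  shows "diam G \<le> c \<longleftrightarrow> (\<forall>x\<in>pverts G. \<forall>y\<in>pverts G. gdist G x y \<le> c)"
proof -
  let ?D = "{gdist G x y | x y. x \<in> pverts G \<and> y \<in> pverts G}"
  have "?D = (\<lambda>(x, y). gdist G x y) ` (pverts G \<times> pverts G)" by auto
  then have "finite ?D" using pair_finite_verts by simp
  moreover have "?D \<noteq> {}" using assms by auto
  ultimately show ?thesis
    unfolding diam_def by (subst Max_le_iff) auto
qed

lemma (in pair_graph) complement_complement: "complement (complement G) = G"
  by (rule pair_pre_digraph.equality)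
    (auto simp: complement_def dest: in_arcsD1 in_arcsD2 no_loops')

text \<open>
  The common neighbour asked for in the complement has to be a vertex different from both ends,
  because the complement has no loops; this is where the condition on \<open>z\<close> comes from.
\<close>

lemma (in pair_graph) common_neighbour_complement_iff:
  assumes "x \<in> pverts G" "y \<in> pverts G"
  shows "(\<exists>z. (x, z) \<in> parcs (complement G) \<and> (z, y) \<in> parcs (complement G)) \<longleftrightarrow>
    (\<exists>z \<in> pverts G - {x, y}. (x, z) \<notin> parcs G \<and> (y, z) \<notin> parcs G)"
  using assms arcs_symmetric by (auto simp: complement_def)

lemma (in pair_graph) arcs_metamour_graph_complement:
  "parcs (metamour_graph (complement G)) =
    {(x, y). (x, y) \<in> parcs G \<and>
      (\<exists>z \<in> pverts G - {x, y}. (x, z) \<notin> parcs G \<and> (y, z) \<notin> parcs G)}"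
proof -
  interpret C: pair_graph "complement G" by (rule pair_graph_complement)
  have verts: "pverts (complement G) = pverts G" by (simp add: complement_def)
  have "gdist (complement G) x y = 2 \<longleftrightarrow> (x, y) \<in> parcs G \<and>
      (\<exists>z \<in> pverts G - {x, y}. (x, z) \<notin> parcs G \<and> (y, z) \<notin> parcs G)"
    if "x \<in> pverts G" "y \<in> pverts G" for x y
  proof -
    have "x \<noteq> y \<and> (x, y) \<notin> parcs (complement G) \<longleftrightarrow> (x, y) \<in> parcs G"
      using that by (auto simp: complement_def dest: no_loops')
    then show ?thesis
      using C.gdist_eq_two_iff[of x y] common_neighbour_complement_iff[OF that] that verts
      by auto
  qed
  then show ?thesis
    by (auto simp: metamour_graph_def verts dest: in_arcsD1 in_arcsD2)
qed

lemma (in pair_graph) metamour_graph_complement_eq_iff: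
  "metamour_graph (complement G) = G \<longleftrightarrow>
    (\<forall>x y. (x, y) \<in> parcs G \<longrightarrow>
      (\<exists>z \<in> pverts G - {x, y}. (x, z) \<notin> parcs G \<and> (y, z) \<notin> parcs G))"
    (is "_ \<longleftrightarrow> ?common")
proof -
  have "pverts (metamour_graph (complement G)) = pverts G"
    by (simp add: metamour_graph_def complement_def)
  then have "metamour_graph (complement G) = G \<longleftrightarrow>
      parcs (metamour_graph (complement G)) = parcs G"
    by (auto intro: pair_pre_digraph.equality)
  also have "\<dots> \<longleftrightarrow> ?common"
    unfolding arcs_metamour_graph_complement by blast
  finally show ?thesis .
qed

text \<open>
  A common neighbour of two metamours is adjacent to both of them, so it is a metamour of neither.
\<close>

lemma (in pair_graph) metamours_common_non_metamour:
  assumes "(x, y) \<in> parcs (metamour_graph G)"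
  shows "\<exists>z \<in> pverts G - {x, y}.
    (x, z) \<notin> parcs (metamour_graph G) \<and> (y, z) \<notin> parcs (metamour_graph G)"
proof -
  have xy: "x \<in> pverts G" "y \<in> pverts G" "gdist G x y = 2"
    using assms by (auto simp: metamour_graph_def)
  obtain z where z: "(x, z) \<in> parcs G" "(z, y) \<in> parcs G"
    using xy gdist_eq_two_iff by blast
  then have yz: "(y, z) \<in> parcs G" using arcs_symmetric by blast
  have "z \<in> pverts G - {x, y}"
    using z in_arcsD2 no_loops' by blast
  moreover have "gdist G x z \<noteq> 2" "gdist G y z \<noteq> 2"
    using gdist_eq_two_iff xy(1,2) z(1) yz by blast+
  ultimately show ?thesis
    by (auto simp: metamour_graph_def)
qed

lemma (in pair_graph) diam_complement_le_two_iff: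
  assumes "pverts G \<noteq> {}"
  shows "diam (complement G) \<le> 2 \<longleftrightarrow>
    (\<forall>x y. (x, y) \<in> parcs G \<longrightarrow>
      (\<exists>z \<in> pverts G - {x, y}. (x, z) \<notin> parcs G \<and> (y, z) \<notin> parcs G))"
proof -
  interpret C: pair_graph "complement G" by (rule pair_graph_complement)
  have verts: "pverts (complement G) = pverts G" by (simp add: complement_def)
  have "gdist (complement G) x y \<le> 2 \<longleftrightarrow> ((x, y) \<in> parcs G \<longrightarrow>
      (\<exists>z \<in> pverts G - {x, y}. (x, z) \<notin> parcs G \<and> (y, z) \<notin> parcs G))"
    if "x \<in> pverts G" "y \<in> pverts G" for x y
  proof -
    have "x = y \<or> (x, y) \<in> parcs (complement G) \<longleftrightarrow> (x, y) \<notin> parcs G"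
      using that by (auto simp: complement_def dest: no_loops')
    then show ?thesis
      using C.gdist_le_two_iff[of x y] common_neighbour_complement_iff[OF that] that verts
      by auto
  qed
  then show ?thesis
    unfolding C.diam_le_iff[unfolded verts, OF assms] using in_arcsD1 in_arcsD2 by (simp; blast)
qed

theorem theorem3p3:
  fixes G :: "'a pair_pre_digraph"
  assumes "pair_graph G" and "pverts G \<noteq> {}"
  shows "((\<exists>G'. pair_graph G' \<and> pverts G' = pverts G \<and> metamour_graph G' = G)
            \<longleftrightarrow> metamour_complementary (complement G))
       \<and> (metamour_complementary (complement G)
            \<longleftrightarrow> metamour_graph (complement G) = G)
       \<and> (metamour_graph (complement G) = G
            \<longleftrightarrow> (\<forall>x y. (x, y) \<in> parcs G \<longrightarrow>
                  (\<exists>z \<in> pverts G - {x, y}. (x, z) \<notin> parcs G \<and> (y, z) \<notin> parcs G)))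
       \<and> ((\<forall>x y. (x, y) \<in> parcs G \<longrightarrow>
                  (\<exists>z \<in> pverts G - {x, y}. (x, z) \<notin> parcs G \<and> (y, z) \<notin> parcs G))
            \<longleftrightarrow> diam (complement G) \<le> 2)"
    (is "(?metamour \<longleftrightarrow> ?mc) \<and> (_ \<longleftrightarrow> ?eq) \<and> (_ \<longleftrightarrow> ?common) \<and> (_ \<longleftrightarrow> ?diam)")
proof -
  interpret pair_graph G by (rule assms(1))
  have mc_eq: "?mc \<longleftrightarrow> ?eq"
    unfolding metamour_complementary_def complement_complement ..
  have eq_common: "?eq \<longleftrightarrow> ?common"
    by (rule metamour_graph_complement_eq_iff)
  have diam: "?common \<longleftrightarrow> ?diam"
    using diam_complement_le_two_iff[OF assms(2)] by blast
  have "?common" if ?metamour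
    using that pair_graph.metamours_common_non_metamour by metis
  moreover have "?metamour" if ?eq
    using that pair_graph_complement by (intro exI[of _ "complement G"]) (simp add: complement_def)
  ultimately show ?thesis
    using mc_eq eq_common diam by blast
qed

end
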